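(* Let $R$ be a relation on $X\times Y$, with both $X$ and $Y$ nonempty. If $R$ preserves attribute privacy and if every $x\in X$ is uniquely identifiable via $R$, then $\Phi_R$ contains no free faces.
   Context: Everything is finite. A relation $R$ on $X\times Y$ is a subset of $X\times Y$. $Y_x=\{y\in Y:(x,y)\in R\}$ and $X_y=\{x\in X:(x,y)\in R\}$. For $\sigma\subseteq X$, $\phi_R(\sigma)=\bigcap_{x\in\sigma}Y_x$ with $\phi_R(\emptyset)=Y$; for $\gamma\subseteq Y$, $\psi_R(\gamma)=\bigcap_{y\in\gamma}X_y$ with $\psi_R(\emptyset)=X$. $\Phi_R$ is the simplicial complex $\{\gamma\subseteq Y:\exists x\in X\ \forall y\in\gamma\ (x,y)\in R\}$, which contains $\emptyset$ as a simplex. $R$ preserves attribute privacy if $(\phi_R\circ\psi_R)(\gamma)=\gamma$ for all $\gamma\in\Phi_R$ (including $\gamma=\emptyset$). An individual $x\in X$ is uniquely identifiable via $R$ if $\psi_R(Y_x)=\{x\}$. A simplex of a simplicial complex is a free face if it is a proper subset of exactly one maximal simplex of the complex; the empty simplex may be a free face. *)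

theory Defs
  imports Main
begin

definition attributes :: "'b set \<Rightarrow> ('a \<times> 'b) set \<Rightarrow> 'a \<Rightarrow> 'b set" where
  "attributes Y R x = {y \<in> Y. (x, y) \<in> R}"

definition individuals :: "'a set \<Rightarrow> ('a \<times> 'b) set \<Rightarrow> 'b \<Rightarrow> 'a set" where
  "individuals X R y = {x \<in> X. (x, y) \<in> R}"

text \<open>The empty intersection is taken inside the carrier, not as \<^const>\<open>UNIV\<close>.\<close>

definition phi :: "'b set \<Rightarrow> ('a \<times> 'b) set \<Rightarrow> 'a set \<Rightarrow> 'b set" where
  "phi Y R \<sigma> = (if \<sigma> = {} then Y else (\<Inter>x\<in>\<sigma>. attributes Y R x))"

definition psi :: "'a set \<Rightarrow> ('a \<times> 'b) set \<Rightarrow> 'b set \<Rightarrow> 'a set" where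
  "psi X R \<gamma> = (if \<gamma> = {} then X else (\<Inter>y\<in>\<gamma>. individuals X R y))"

definition Phi_complex :: "'a set \<Rightarrow> 'b set \<Rightarrow> ('a \<times> 'b) set \<Rightarrow> 'b set set" where
  "Phi_complex X Y R = {\<gamma>. \<gamma> \<subseteq> Y \<and> (\<exists>x\<in>X. \<forall>y\<in>\<gamma>. (x, y) \<in> R)}"

definition preserves_attribute_privacy :: "'a set \<Rightarrow> 'b set \<Rightarrow> ('a \<times> 'b) set \<Rightarrow> bool" where
  "preserves_attribute_privacy X Y R \<longleftrightarrow>
     (\<forall>\<gamma> \<in> Phi_complex X Y R. (phi Y R \<circ> psi X R) \<gamma> = \<gamma>)"

definition uniquely_identifiable :: "'a set \<Rightarrow> 'b set \<Rightarrow> ('a \<times> 'b) set \<Rightarrow> 'a \<Rightarrow> bool" where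
  "uniquely_identifiable X Y R x \<longleftrightarrow> psi X R (attributes Y R x) = {x}"

text \<open>Complexes are given by their sets of simplices; the empty set may be a simplex.\<close>

definition maximal_simplex :: "'v set set \<Rightarrow> 'v set \<Rightarrow> bool" where
  "maximal_simplex K \<tau> \<longleftrightarrow> \<tau> \<in> K \<and> (\<forall>\<rho>\<in>K. \<tau> \<subseteq> \<rho> \<longrightarrow> \<rho> = \<tau>)"

definition free_face :: "'v set set \<Rightarrow> 'v set \<Rightarrow> bool" where
  "free_face K \<sigma> \<longleftrightarrow> \<sigma> \<in> K \<and> (\<exists>!\<tau>. maximal_simplex K \<tau> \<and> \<sigma> \<subset> \<tau>)"

end

theory Submission
  imports Defs
begin

text \<open>
  If every individual is uniquely identifiable, each \<open>Y\<^sub>x\<close> is a maximal simplex. Hence if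
  \<open>Y\<^sub>x\<close> is the only maximal simplex properly containing \<open>\<gamma>\<close>, then \<open>x\<close> is the only individual
  with all attributes in \<open>\<gamma>\<close>, so the closure of \<open>\<gamma>\<close> is \<open>Y\<^sub>x \<noteq> \<gamma>\<close>, contradicting privacy.
\<close>

lemma mem_Phi_complex_iff:
  "\<gamma> \<in> Phi_complex X Y R \<longleftrightarrow> (\<exists>x\<in>X. \<gamma> \<subseteq> attributes Y R x)"
  by (auto simp: Phi_complex_def attributes_def)

text \<open>\<open>attributes\<close> is cut down to \<open>Y\<close> but \<open>individuals\<close>
  is not, hence the assumption on \<gamma>. For empty \<gamma> both sides reduce to membership in
  \<open>X\<close>.\<close>

lemma mem_psi_iff:
  assumes "\<gamma> \<subseteq> Y"
  shows "x \<in> psi X R \<gamma> \<longleftrightarrow> x \<in> X \<and> \<gamma> \<subseteq> attributes Y R x"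
  using assms by (auto simp: psi_def individuals_def attributes_def)

lemma attributes_subset: "attributes Y R x \<subseteq> Y"
  by (auto simp: attributes_def)

lemma phi_singleton: "phi Y R {x} = attributes Y R x"
  by (simp add: phi_def)

text \<open>Having all attributes of \<open>x\<close> puts \<open>x'\<close> into
  \<open>psi X R (attributes Y R x)\<close>, which is \<open>{x}\<close>.\<close>

lemma uniquely_identifiable_attributes_subsetD:
  assumes "uniquely_identifiable X Y R x" and "x' \<in> X"
    and "attributes Y R x \<subseteq> attributes Y R x'"
  shows "x' = x"
  using assms mem_psi_iff[of "attributes Y R x" Y x' X R, OF attributes_subset]
  by (simp add: uniquely_identifiable_def)

text \<open>A simplex above \<open>attributes Y R x\<close> lies in turn below some
  \<open>attributes Y R x'\<close>; identifiability forces \<open>x' = x\<close>, so the chain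
  collapses.\<close>

lemma maximal_simplex_attributes:
  assumes "uniquely_identifiable X Y R x" and "x \<in> X"
  shows "maximal_simplex (Phi_complex X Y R) (attributes Y R x)"
  unfolding maximal_simplex_def
proof (intro conjI ballI impI)
  show "attributes Y R x \<in> Phi_complex X Y R"
    using assms(2) by (auto simp: mem_Phi_complex_iff)
next
  fix \<rho> assume "\<rho> \<in> Phi_complex X Y R" and sub: "attributes Y R x \<subseteq> \<rho>"
  then obtain x' where "x' \<in> X" and \<rho>: "\<rho> \<subseteq> attributes Y R x'"
    using assms(2) by (auto simp: mem_Phi_complex_iff)
  have "attributes Y R x \<subseteq> attributes Y R x'" using sub \<rho> by (rule subset_trans)
  with \<open>x' \<in> X\<close> have "x' = x"
    using uniquely_identifiable_attributes_subsetD[OF assms(1)] by simp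
  with \<rho> sub show "\<rho> = attributes Y R x" by simp
qed

theorem lemma63:
  fixes X :: "'a set" and Y :: "'b set" and R :: "('a \<times> 'b) set"
  assumes "finite X" and "finite Y"
    and "X \<noteq> {}" and "Y \<noteq> {}"
    and "R \<subseteq> X \<times> Y"
    and "preserves_attribute_privacy X Y R"
    and "\<forall>x\<in>X. uniquely_identifiable X Y R x"
  shows "\<not> (\<exists>\<gamma>. free_face (Phi_complex X Y R) \<gamma>)"
proof
  let ?K = "Phi_complex X Y R"
  assume "\<exists>\<gamma>. free_face ?K \<gamma>"
  then obtain \<gamma> where \<gamma>: "\<gamma> \<in> ?K" and ex1: "\<exists>!\<tau>. maximal_simplex ?K \<tau> \<and> \<gamma> \<subset> \<tau>"
    unfolding free_face_def by (elim exE conjE)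
  from ex1 obtain \<tau> where \<tau>: "maximal_simplex ?K \<tau>" "\<gamma> \<subset> \<tau>"
    by (elim ex1E conjE)
  have unique: "\<rho> = \<tau>" if "maximal_simplex ?K \<rho>" "\<gamma> \<subset> \<rho>" for \<rho>
    using Uniq_D[OF ex1_iff_ex_Uniq[THEN iffD1, OF ex1, THEN conjunct2]] that \<tau> by simp
  have max: "maximal_simplex ?K (attributes Y R x)" if "x \<in> X" for x
    by (rule maximal_simplex_attributes[OF assms(7)[rule_format, OF that] that])
  \<comment> \<open>As a simplex, \<tau> lies below the attribute set of some \<open>x\<close>,
    itself a simplex; maximality of \<tau> then gives equality.\<close>
  obtain x where "x \<in> X" "\<tau> \<subseteq> attributes Y R x"
    using \<tau>(1) unfolding maximal_simplex_def mem_Phi_complex_iff by (elim conjE bexE)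
  with \<tau>(1) max[of x] have x: "x \<in> X" "\<tau> = attributes Y R x"
    unfolding maximal_simplex_def by simp_all
  have only_x: "x' = x" if x': "x' \<in> X" "\<gamma> \<subseteq> attributes Y R x'" for x'
  proof -
    \<comment> \<open>\<open>unique\<close> needs a proper inclusion. Equality would make \<gamma>
      maximal, although it lies strictly below the simplex \<tau>.\<close>
    have "\<gamma> \<noteq> attributes Y R x'"
      using max[OF x'(1)] \<tau> by (auto simp: maximal_simplex_def)
    with x' have "attributes Y R x' = \<tau>"
      using unique[OF max] by (simp add: psubset_eq)
    with x(2) have "attributes Y R x \<subseteq> attributes Y R x'" by simp
    with x(1) x'(1) show ?thesis
      using uniquely_identifiable_attributes_subsetD[OF assms(7)[rule_format]] by simp
  qed
  \<comment> \<open>With this inclusion \<open>mem_psi_iff\<close> applies: \<open>only_x\<close>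
    bounds \<open>psi X R \<gamma>\<close> by \<open>{x}\<close>, and \<open>x\<close> belongs to it
    because \<gamma> lies below \<tau>.\<close>
  have "\<gamma> \<subseteq> Y" using \<tau>(2) x(2) attributes_subset[of Y R x] by simp
  then have "x' \<in> psi X R \<gamma> \<longleftrightarrow> x' = x" for x'
    using only_x[of x'] x \<tau>(2) by (auto simp: mem_psi_iff)
  then have "psi X R \<gamma> = {x}" by blast
  then have "phi Y R (psi X R \<gamma>) = \<tau>"
    by (simp add: phi_singleton x(2))
  moreover have "phi Y R (psi X R \<gamma>) = \<gamma>"
    using assms(6) \<gamma> by (simp add: preserves_attribute_privacy_def)
  ultimately show False using \<tau>(2) by simp
qed

end
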